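(* Let $X\in\mathbb R^{p_1\times\cdots\times p_K\times n}$, $p=\prod_{k=1}^Kp_k$, and let $(\sigma,\Psi_1,\dots,\Psi_K)$, with $\sigma>0$ and $\Psi_k\in\mathcal G_{p_k}^+$, have the posterior density $$p(\sigma,\Psi_1,\dots,\Psi_K\mid X)\propto\sigma^{-np}\exp\left\{-\frac1{2\sigma^2}\bigl\|X\times\{\Psi_1^{-1},\dots,\Psi_K^{-1},I_n\}\bigr\|^2\right\}\frac1\sigma\prod_{k=1}^K\prod_{i=2}^{p_k}\Psi_{k[i,i]}^{\,i-2}.$$ Let $\Sigma_k=\Psi_k\Psi_k^T$ and let $$\mathcal E_k=\Bigl(\mathrm E\bigl[(\sigma^2\Sigma_k)^{-1}\mid X\bigr]\Bigr)^{-1},$$ the expectation being with respect to this posterior distribution. The minimizer of the posterior expectation $$\mathrm E\left[\left.\frac{s^2}{\sigma^2}\sum_{k=1}^K\frac p{p_k}\mathrm{tr}\bigl[S_k^T\Sigma_k^{-1}\bigr]-Kp\log\left(\frac{s^2}{\sigma^2}\right)-Kp\ \right|X\right]$$ with respect to $s>0$ and the $S_k$'s (each $S_k$ a $p_k\times p_k$ positive definite matrix with $|S_k|=1$) is $$\hat\Sigma_k=\mathcal E_k/|\mathcal E_k|^{1/p_k}\quad(k=1,\dots,K),\qquad \hat\sigma^2=\left(\sum_{k=1}^K\frac1K|\mathcal E_k|^{-1/p_k}\right)^{-1},$$ that is, $S_k=\hat\Sigma_k$ and $s^2=\hat\sigma^2$.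
   Context: $\mathcal G_q^+$ is the group of $q\times q$ real lower triangular matrices with positive diagonal entries and determinant $1$; $\Psi_{k[i,j]}$ is the $(i,j)$ entry of $\Psi_k$; $|\cdot|$ of a matrix is the determinant. The posterior density is with respect to Lebesgue measure in the coordinates $\sigma>0$ and $\{\Psi_{k[i,j]}:2\le i\le p_k,1\le j\le i\}$ (with $\Psi_{k[i,i]}>0$), where $\Psi_{k[1,1]}=\prod_{i=2}^{p_k}\Psi_{k[i,i]}^{-1}$. The Tucker product is defined by $\mathrm{vec}(Z\times\{A_1,\dots,A_m\})=(A_m\otimes\cdots\otimes A_1)\mathrm{vec}(Z)$; $\|\cdot\|$ is the Frobenius norm of an array. *)

theory Defs
  imports
    "HOL-Probability.Probability"
    "Jordan_Normal_Form.Determinant"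
    "Jordan_Normal_Form.Gauss_Jordan_Elimination"
begin

no_notation Finite_Cartesian_Product.vec_nth (infixl "$" 90)
hide_const (open) Finite_Cartesian_Product.mat Finite_Cartesian_Product.vec
  Determinants.det Determinants.trace

(* Matrices of varying size are Jordan_Normal_Form matrices, whose rows and columns are
   indexed from 0.  The modes k of the array run over {1..K}; p k is the k-th dimension. *)

(* Unspecified for singular matrices. *)

definition mat_inv :: "real mat \<Rightarrow> real mat" where
  "mat_inv A = the (mat_inverse A)"

definition mat_trace :: "real mat \<Rightarrow> real" where
  "mat_trace A = (\<Sum>i<dim_row A. A $$ (i, i))"

definition pos_def_mat :: "nat \<Rightarrow> real mat \<Rightarrow> bool" where
  "pos_def_mat q A \<longleftrightarrow> A \<in> carrier_mat q q \<and> transpose_mat A = A \<and>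
     (\<forall>v \<in> carrier_vec q. v \<noteq> 0\<^sub>v q \<longrightarrow> 0 < v \<bullet> (A *\<^sub>v v))"

definition Gplus :: "nat \<Rightarrow> real mat set" where
  "Gplus q = {A \<in> carrier_mat q q.
     (\<forall>i<q. \<forall>j<q. i < j \<longrightarrow> A $$ (i, j) = 0) \<and> (\<forall>i<q. 0 < A $$ (i, i)) \<and> det A = 1}"

definition kron :: "real mat \<Rightarrow> real mat \<Rightarrow> real mat" where
  "kron A B = mat (dim_row A * dim_row B) (dim_col A * dim_col B)
     (\<lambda>(r, c). A $$ (r div dim_row B, c div dim_col B) * B $$ (r mod dim_row B, c mod dim_col B))"

(* An array with dimensions ds is a function on nat lists; only its values on
   multi_indices ds matter. *)

definition multi_indices :: "nat list \<Rightarrow> nat list set" where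
  "multi_indices ds = {ix. length ix = length ds \<and> (\<forall>m<length ds. ix ! m < ds ! m)}"

(* vec lists the entries of an array with the first index varying fastest: lin_index is the
   position of a multi-index in vec, and multi_index the multi-index at a given position. *)

fun lin_index :: "nat list \<Rightarrow> nat list \<Rightarrow> nat" where
  "lin_index (d # ds) (i # ix) = i + d * lin_index ds ix"
| "lin_index _ _ = 0"

fun multi_index :: "nat list \<Rightarrow> nat \<Rightarrow> nat list" where
  "multi_index [] r = []"
| "multi_index (d # ds) r = (r mod d) # multi_index ds (r div d)"

lemma multi_index_lin_index:
  "ix \<in> multi_indices ds \<Longrightarrow> multi_index ds (lin_index ds ix) = ix"
proof (induction ds ix rule: lin_index.induct)
  case (1 d ds i ix)
  then have "i < d" "ix \<in> multi_indices ds"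
    by (force simp: multi_indices_def)+
  with 1 show ?case by simp
qed (auto simp: multi_indices_def)

definition array_vec :: "nat list \<Rightarrow> (nat list \<Rightarrow> real) \<Rightarrow> real vec" where
  "array_vec ds Z = vec (prod_list ds) (\<lambda>r. Z (multi_index ds r))"

(* kron_rev [A_1, ..., A_m] is the Kronecker product of A_m, ..., A_1, in this order. *)

fun kron_rev :: "real mat list \<Rightarrow> real mat" where
  "kron_rev [] = 1\<^sub>m 1"
| "kron_rev (A # As) = kron (kron_rev As) A"

definition tucker :: "(nat list \<Rightarrow> real) \<Rightarrow> real mat list \<Rightarrow> nat list \<Rightarrow> real" where
  "tucker Z As ix =
     (kron_rev As *\<^sub>v array_vec (map dim_col As) Z) $ lin_index (map dim_row As) ix"

definition array_norm :: "nat list \<Rightarrow> (nat list \<Rightarrow> real) \<Rightarrow> real" where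
  "array_norm ds Z = sqrt (\<Sum>ix \<in> multi_indices ds. (Z ix)\<^sup>2)"

(* The free coordinates of the matrices Psi_k: the entries on and below the diagonal,
   except the top left one, which is determined by det Psi_k = 1. *)

definition coord_idx :: "nat \<Rightarrow> (nat \<Rightarrow> nat) \<Rightarrow> (nat \<times> nat \<times> nat) set" where
  "coord_idx K p = {(k, i, j). k \<in> {1..K} \<and> i \<in> {1..<p k} \<and> j \<le> i}"

type_synonym param = "real \<times> (nat \<times> nat \<times> nat \<Rightarrow> real)"

definition param_lebesgue :: "nat \<Rightarrow> (nat \<Rightarrow> nat) \<Rightarrow> param measure" where
  "param_lebesgue K p = lborel \<Otimes>\<^sub>M (\<Pi>\<^sub>M c \<in> coord_idx K p. lborel)"

definition sig :: "param \<Rightarrow> real" where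
  "sig w = fst w"

definition Psi :: "(nat \<Rightarrow> nat) \<Rightarrow> param \<Rightarrow> nat \<Rightarrow> real mat" where
  "Psi p w k = mat (p k) (p k) (\<lambda>(i, j).
     if i = 0 \<and> j = 0 then (\<Prod>l = 1..<p k. inverse (snd w (k, l, l)))
     else if j \<le> i then snd w (k, i, j) else 0)"

definition Sig :: "(nat \<Rightarrow> nat) \<Rightarrow> param \<Rightarrow> nat \<Rightarrow> real mat" where
  "Sig p w k = Psi p w k * transpose_mat (Psi p w k)"

definition total_dim :: "nat \<Rightarrow> (nat \<Rightarrow> nat) \<Rightarrow> nat" where
  "total_dim K p = (\<Prod>k = 1..K. p k)"

definition array_dims :: "nat \<Rightarrow> (nat \<Rightarrow> nat) \<Rightarrow> nat \<Rightarrow> nat list" where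
  "array_dims K p n = map p [1..<Suc K] @ [n]"

(* The exponent i - 2 for rows i counted from 1 becomes i - 1 for rows counted from 0. *)

definition post_kernel ::
    "nat \<Rightarrow> (nat \<Rightarrow> nat) \<Rightarrow> nat \<Rightarrow> (nat list \<Rightarrow> real) \<Rightarrow> param \<Rightarrow> real" where
  "post_kernel K p n X w =
     (if 0 < sig w \<and> (\<forall>k \<in> {1..K}. Psi p w k \<in> Gplus (p k)) then
        sig w powi (- int (n * total_dim K p)) *
        exp (- (1 / (2 * (sig w)\<^sup>2)) *
          (array_norm (array_dims K p n)
            (tucker X (map (\<lambda>k. mat_inv (Psi p w k)) [1..<Suc K] @ [1\<^sub>m n])))\<^sup>2) *
        (1 / sig w) * (\<Prod>k = 1..K. \<Prod>i = 1..<p k. (Psi p w k $$ (i, i)) ^ (i - 1))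
      else 0)"

(* "Proportional to the kernel": the constant c is forced to be the reciprocal of the
   integral of the kernel, so the kernel is required to be integrable. *)

definition is_posterior ::
    "nat \<Rightarrow> (nat \<Rightarrow> nat) \<Rightarrow> nat \<Rightarrow> (nat list \<Rightarrow> real) \<Rightarrow> param measure \<Rightarrow> bool" where
  "is_posterior K p n X M \<longleftrightarrow> prob_space M \<and>
     (\<exists>c. M = density (param_lebesgue K p) (\<lambda>w. ennreal (c * post_kernel K p n X w)))"

definition mat_expectation :: "'a measure \<Rightarrow> nat \<Rightarrow> ('a \<Rightarrow> real mat) \<Rightarrow> real mat" where
  "mat_expectation M q F = mat q q (\<lambda>(i, j). integral\<^sup>L M (\<lambda>w. F w $$ (i, j)))"

definition precision :: "(nat \<Rightarrow> nat) \<Rightarrow> param \<Rightarrow> nat \<Rightarrow> real mat" where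
  "precision p w k = mat_inv ((sig w)\<^sup>2 \<cdot>\<^sub>m Sig p w k)"

definition E_mat :: "(nat \<Rightarrow> nat) \<Rightarrow> param measure \<Rightarrow> nat \<Rightarrow> real mat" where
  "E_mat p M k = mat_inv (mat_expectation M (p k) (\<lambda>w. precision p w k))"

definition loss ::
    "nat \<Rightarrow> (nat \<Rightarrow> nat) \<Rightarrow> param \<Rightarrow> real \<Rightarrow> (nat \<Rightarrow> real mat) \<Rightarrow> real" where
  "loss K p w s S =
     s\<^sup>2 / (sig w)\<^sup>2 * (\<Sum>k = 1..K. real (total_dim K p) / real (p k) *
        mat_trace (transpose_mat (S k) * mat_inv (Sig p w k)))
     - real K * real (total_dim K p) * ln (s\<^sup>2 / (sig w)\<^sup>2) - real K * real (total_dim K p)"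

definition post_risk ::
    "nat \<Rightarrow> (nat \<Rightarrow> nat) \<Rightarrow> param measure \<Rightarrow> real \<Rightarrow> (nat \<Rightarrow> real mat) \<Rightarrow> real" where
  "post_risk K p M s S = integral\<^sup>L M (\<lambda>w. loss K p w s S)"

definition admissible :: "nat \<Rightarrow> (nat \<Rightarrow> nat) \<Rightarrow> real \<Rightarrow> (nat \<Rightarrow> real mat) \<Rightarrow> bool" where
  "admissible K p s S \<longleftrightarrow> 0 < s \<and> (\<forall>k \<in> {1..K}. pos_def_mat (p k) (S k) \<and> det (S k) = 1)"

definition Sigma_hat :: "(nat \<Rightarrow> nat) \<Rightarrow> param measure \<Rightarrow> nat \<Rightarrow> real mat" where
  "Sigma_hat p M k = (1 / det (E_mat p M k) powr (1 / real (p k))) \<cdot>\<^sub>m E_mat p M k"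

definition sigma2_hat :: "nat \<Rightarrow> (nat \<Rightarrow> nat) \<Rightarrow> param measure \<Rightarrow> real" where
  "sigma2_hat K p M =
     inverse (\<Sum>k = 1..K. 1 / real K * det (E_mat p M k) powr (- 1 / real (p k)))"

end

theory Submission
  imports Defs
begin

text \<open>Write \<open>A\<^sub>k = \<E>\<^sub>k\<inverse>\<close> for the posterior mean of \<open>(\<sigma>\<^sup>2 \<Sigma>\<^sub>k)\<inverse>\<close>. Up to an additive
  constant the posterior risk is \<open>p (s\<^sup>2 \<Sum>\<^sub>k tr (S\<^sub>k A\<^sub>k) / p\<^sub>k - K ln s\<^sup>2)\<close>. By the arithmetic-geometric
  mean inequality for eigenvalues, \<open>tr (S A) \<ge> q (det A) powr (1/q)\<close> whenever \<open>det S = 1\<close>, with equality only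
  for \<open>S\<close> a multiple of \<open>A\<inverse>\<close>; so every \<open>S\<^sub>k\<close> can be optimised independently of \<open>s\<close>, and what
  remains is the minimisation of \<open>x D - K ln x\<close> over \<open>x = s\<^sup>2\<close>. Eigenvalues are avoided: the
  inequality is read off a Cholesky factor, whose squared entries sum to the trace and whose
  squared diagonal entries multiply to the determinant.\<close>

section \<open>Inverses, positive definiteness and Cholesky factors\<close>

lemma mat_inv_unique:
  assumes "A \<in> carrier_mat q q" "B \<in> carrier_mat q q" "A * B = 1\<^sub>m q"
  shows "mat_inv A = B"
proof -
  \<comment> \<open>A one-sided inverse of a square matrix is two-sided, so \<open>A\<close> is a
    unit and \<open>mat_inverse A\<close> cannot be \<open>None\<close>.\<close>
  have BA: "B * A = 1\<^sub>m q"
    using mat_mult_left_right_inverse[OF assms] .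
  show ?thesis
  proof (cases "mat_inverse A")
    case None
    then have "A \<notin> Units (ring_mat TYPE(real) q undefined)"
      by (rule mat_inverse(1)[OF assms(1)])
    with assms BA show ?thesis
      by (auto simp: Units_def ring_mat_def)
  next
    case (Some C)
    then have C: "A * C = 1\<^sub>m q" "C \<in> carrier_mat q q"
      using mat_inverse(2)[OF assms(1) Some] by auto
    have "C = (B * A) * C" using BA C(2) by simp
    also have "\<dots> = B * (A * C)" using assms C by (intro assoc_mult_mat) auto
    also have "\<dots> = B" using C(1) assms(2) by simp
    finally show ?thesis using Some by (simp add: mat_inv_def)
  qed
qed

lemma det_nonzero_inverse:
  assumes "A \<in> carrier_mat q q" "det A \<noteq> (0::real)"
  obtains B where "B \<in> carrier_mat q q" "A * B = 1\<^sub>m q" "B * A = 1\<^sub>m q"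
  using det_non_zero_imp_unit[OF assms, of undefined]
  by (auto simp: Units_def ring_mat_def)

lemma quadratic_form_sum:
  fixes A :: "real mat"
  assumes "A \<in> carrier_mat q q" "v \<in> carrier_vec q"
  shows "scalar_prod v (A *\<^sub>v v) = (\<Sum>i<q. \<Sum>j<q. v $ i * A $$ (i, j) * v $ j)"
  using assms
  by (auto simp: scalar_prod_def atLeast0LessThan sum_distrib_left mult.assoc intro!: sum.cong)

lemma transpose_mult_eq_1:
  fixes A B :: "real mat"
  assumes "A \<in> carrier_mat q q" "B \<in> carrier_mat q q" "A * B = 1\<^sub>m q"
  shows "transpose_mat B * transpose_mat A = 1\<^sub>m q"
  using transpose_mult[OF assms(1,2)] assms(3) by simp

lemma pos_def_mat_1: "pos_def_mat q (1\<^sub>m q)"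
proof -
  have "0 < scalar_prod v v" if v: "v \<in> carrier_vec q" "v \<noteq> 0\<^sub>v q" for v :: "real vec"
  proof -
    obtain i where i: "i < q" "v $ i \<noteq> 0"
      using v by (metis carrier_vecD eq_vecI index_zero_vec)
    have "0 < v $ i * v $ i" using i by (metis not_real_square_gt_zero)
    also have "\<dots> \<le> scalar_prod v v"
      using v i unfolding scalar_prod_def
      by (intro member_le_sum) auto
    finally show ?thesis .
  qed
  then show ?thesis by (auto simp: pos_def_mat_def)
qed

text \<open>The quadratic form of the new matrix at \<open>v\<close> is that of \<open>A\<close> at
  the transpose of \<open>L\<close> applied to \<open>v\<close>. The right inverse \<open>R\<close>
  guarantees that this vector is nonzero whenever \<open>v\<close> is.\<close>

lemma pos_def_mat_congruence:
  assumes A: "pos_def_mat q A" and L: "L \<in> carrier_mat q q" and R: "R \<in> carrier_mat q q"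
    and LR: "L * R = 1\<^sub>m q"
  shows "pos_def_mat q (L * A * transpose_mat L)"
proof -
  have Ac: "A \<in> carrier_mat q q" and At: "transpose_mat A = A"
    using A by (auto simp: pos_def_mat_def)
  have "transpose_mat (L * A * transpose_mat L) = L * (transpose_mat A * transpose_mat L)"
    using L Ac by (simp add: transpose_mult[of _ q q _ q] assoc_mult_mat[of _ q q _ q _ q])
  also have "\<dots> = L * A * transpose_mat L"
    using L Ac At by (simp add: assoc_mult_mat[of _ q q _ q _ q])
  finally have sym: "transpose_mat (L * A * transpose_mat L) = L * A * transpose_mat L" .
  have "0 < scalar_prod v (L * A * transpose_mat L *\<^sub>v v)"
    if v: "v \<in> carrier_vec q" "v \<noteq> 0\<^sub>v q" for v
  proof -
    define u where "u = transpose_mat L *\<^sub>v v"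
    have u: "u \<in> carrier_vec q" using L v by (simp add: u_def)
    have "transpose_mat R *\<^sub>v u = (transpose_mat R * transpose_mat L) *\<^sub>v v"
      using L R v by (simp add: u_def assoc_mult_mat_vec[of _ q q _ q])
    also have "transpose_mat R * transpose_mat L = 1\<^sub>m q"
      using L R LR by (rule transpose_mult_eq_1)
    finally have "transpose_mat R *\<^sub>v u = v" using v by simp
    moreover have "transpose_mat R *\<^sub>v 0\<^sub>v q = 0\<^sub>v q"
      using R by (intro eq_vecI) (auto simp: scalar_prod_def)
    ultimately have "u \<noteq> 0\<^sub>v q" using v(2) by metis
    then have "0 < scalar_prod u (A *\<^sub>v u)"
      using A u by (auto simp: pos_def_mat_def)
    also have "\<dots> = scalar_prod v (L *\<^sub>v (A *\<^sub>v u))"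
      unfolding u_def using L Ac v
      by (intro transpose_vec_mult_scalar[of L q q]) auto
    also have "L *\<^sub>v (A *\<^sub>v u) = L * A * transpose_mat L *\<^sub>v v"
      using L Ac v by (simp add: u_def assoc_mult_mat_vec[of _ q q _ q])
    finally show ?thesis .
  qed
  with sym L Ac show ?thesis by (auto simp: pos_def_mat_def)
qed

lemma pos_def_mat_gram:
  assumes "L \<in> carrier_mat q q" "R \<in> carrier_mat q q" "L * R = 1\<^sub>m q"
  shows "pos_def_mat q (L * transpose_mat L)"
  using pos_def_mat_congruence[OF pos_def_mat_1 assms] assms(1) by simp

lemma pos_def_mat_smult:
  assumes "pos_def_mat q A" "0 < c"
  shows "pos_def_mat q (c \<cdot>\<^sub>m A)"
proof -
  have A: "A \<in> carrier_mat q q" "transpose_mat A = A"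
    using assms(1) by (auto simp: pos_def_mat_def)
  have "transpose_mat (c \<cdot>\<^sub>m A) = c \<cdot>\<^sub>m transpose_mat A"
    by (intro eq_matI) auto
  moreover have "scalar_prod v (c \<cdot>\<^sub>m A *\<^sub>v v) = c * scalar_prod v (A *\<^sub>v v)"
    if "v \<in> carrier_vec q" for v
    using A that
    by (simp add: quadratic_form_sum[of _ q] sum_distrib_left mult_ac)
  ultimately show ?thesis
    using assms A by (auto simp: pos_def_mat_def)
qed

text \<open>Induction on the size: the Schur complement of the top left entry is again positive
  definite, since its quadratic form is that of \<^term>\<open>A\<close> minimised over the first coordinate.\<close>

lemma cholesky:
  assumes "pos_def_mat q A"
  shows "\<exists>L \<in> carrier_mat q q. (\<forall>i<q. \<forall>j<q. i < j \<longrightarrow> L $$ (i, j) = 0) \<and>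
    (\<forall>i<q. 0 < L $$ (i, i)) \<and> A = L * transpose_mat L"
  using assms
proof (induction q arbitrary: A)
  case 0
  then show ?case
    by (intro bexI[of _ A]) (auto simp: pos_def_mat_def)
next
  case (Suc q)
  have A: "A \<in> carrier_mat (Suc q) (Suc q)" and At: "transpose_mat A = A"
    and pos: "\<And>v. v \<in> carrier_vec (Suc q) \<Longrightarrow> v \<noteq> 0\<^sub>v (Suc q) \<Longrightarrow> 0 < scalar_prod v (A *\<^sub>v v)"
    using Suc.prems by (auto simp: pos_def_mat_def)
  have sym: "A $$ (i, j) = A $$ (j, i)" if "i \<le> q" "j \<le> q" for i j
    using arg_cong[OF At, of "\<lambda>B. B $$ (i, j)"] A that by (simp add: less_Suc_eq_le)
  define a where "a = A $$ (0, 0)"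
  have "unit_vec (Suc q) 0 \<noteq> (0\<^sub>v (Suc q) :: real vec)"
    by (metis index_unit_vec(1) index_zero_vec(1) zero_less_Suc zero_neq_one)
  then have "0 < scalar_prod (unit_vec (Suc q) 0) (A *\<^sub>v unit_vec (Suc q) 0)"
    by (intro pos) auto
  also have "\<dots> = a"
    using A by (simp add: quadratic_form_sum[of _ "Suc q"] a_def sum.lessThan_Suc_shift del: sum.lessThan_Suc)
  finally have a: "0 < a" .
  define B where "B = mat q q (\<lambda>(i, j). A $$ (Suc i, Suc j) - A $$ (Suc i, 0) * A $$ (0, Suc j) / a)"
  have B: "B \<in> carrier_mat q q" by (simp add: B_def)
  have "pos_def_mat q B"
    unfolding pos_def_mat_def
  proof (intro conjI ballI impI)
    show "transpose_mat B = B"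
      by (intro eq_matI) (auto simp: B_def sym)
    fix v :: "real vec" assume v: "v \<in> carrier_vec q" "v \<noteq> 0\<^sub>v q"
    define b where "b = (\<Sum>j<q. A $$ (0, Suc j) * v $ j)"
    \<comment> \<open>As a function of its first coordinate x, the form of \<open>A\<close> at (x,
      \<open>v\<close>) is a x^2 + 2 b x plus a constant. The value \<open>- b / a\<close> is its
      minimiser, and the minimum is the form of \<open>B\<close> at \<open>v\<close>.\<close>
    define u where "u = vec (Suc q) (\<lambda>i. case i of 0 \<Rightarrow> - b / a | Suc i \<Rightarrow> v $ i)"
    obtain i where i: "i < q" "v $ i \<noteq> 0"
      using v by (metis carrier_vecD eq_vecI index_zero_vec)
    then have "u $ Suc i \<noteq> 0\<^sub>v (Suc q) $ Suc i" by (simp add: u_def)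
    then have "0 < scalar_prod u (A *\<^sub>v u)"
      by (intro pos) (auto simp: u_def)
    also have "\<dots> = (\<Sum>i<Suc q. \<Sum>j<Suc q. u $ i * A $$ (i, j) * u $ j)"
      using A by (intro quadratic_form_sum) (auto simp: u_def)
    also have "\<dots> = (\<Sum>j<Suc q. u $ 0 * A $$ (0, j) * u $ j)
        + (\<Sum>i<q. \<Sum>j<Suc q. u $ Suc i * A $$ (Suc i, j) * u $ j)"
      by (rule sum.lessThan_Suc_shift)
    also have "(\<Sum>j<Suc q. u $ 0 * A $$ (0, j) * u $ j) = (b / a) * a * (b / a) - (b / a) * b"
      unfolding sum.lessThan_Suc_shift
      by (simp add: u_def a_def b_def sum_distrib_left sum_negf mult.assoc)
    also have "(\<Sum>i<q. \<Sum>j<Suc q. u $ Suc i * A $$ (Suc i, j) * u $ j)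
        = (\<Sum>i<q. v $ i * A $$ (Suc i, 0) * (- b / a)) +
          (\<Sum>i<q. \<Sum>j<q. v $ i * A $$ (Suc i, Suc j) * v $ j)"
      unfolding sum.lessThan_Suc_shift by (simp add: u_def sum.distrib sum_negf sum_subtractf)
    also have "(\<Sum>i<q. v $ i * A $$ (Suc i, 0) * (- b / a)) = b * (- b / a)"
      unfolding sum_distrib_right[symmetric]
      by (intro arg_cong[of _ _ "\<lambda>x. x * (- b / a)"]) (simp add: b_def sym mult.commute)
    also have "(b / a) * a * (b / a) - (b / a) * b +
        (b * (- b / a) + (\<Sum>i<q. \<Sum>j<q. v $ i * A $$ (Suc i, Suc j) * v $ j))
        = (\<Sum>i<q. \<Sum>j<q. v $ i * A $$ (Suc i, Suc j) * v $ j) - b * b / a"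
      using a by simp
    also have "b * b / a = (\<Sum>i<q. \<Sum>j<q. v $ i * (A $$ (Suc i, 0) * A $$ (0, Suc j) / a) * v $ j)"
      by (simp add: b_def sum_product sum_divide_distrib sym mult_ac)
    also have "(\<Sum>i<q. \<Sum>j<q. v $ i * A $$ (Suc i, Suc j) * v $ j) - \<dots> = scalar_prod v (B *\<^sub>v v)"
      using B v by (simp add: quadratic_form_sum[of _ q] B_def sum_subtractf[symmetric] algebra_simps)
    finally show "0 < scalar_prod v (B *\<^sub>v v)" .
  qed (rule B)
  from Suc.IH[OF this] obtain L where L: "L \<in> carrier_mat q q"
    and low: "\<And>i j. i < q \<Longrightarrow> j < q \<Longrightarrow> i < j \<Longrightarrow> L $$ (i, j) = 0"
    and diag: "\<And>i. i < q \<Longrightarrow> 0 < L $$ (i, i)" and BL: "B = L * transpose_mat L"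
    by blast
  have BL': "A $$ (Suc i, Suc j) = A $$ (Suc i, 0) * A $$ (0, Suc j) / a
      + (\<Sum>k<q. L $$ (i, k) * L $$ (j, k))" if "i < q" "j < q" for i j
    using arg_cong[OF BL, of "\<lambda>B. B $$ (i, j)"] that L
    by (simp add: B_def scalar_prod_def atLeast0LessThan)
  \<comment> \<open>The first column of \<open>A\<close> divided by \<open>sqrt a\<close> restores
    the rank-one term subtracted in \<open>B\<close>; the factor \<open>L\<close> of
    \<open>B\<close> fills the remaining block, shifted by one row and column.\<close>
  define N where "N = mat (Suc q) (Suc q) (\<lambda>(i, j). case j of 0 \<Rightarrow> A $$ (i, 0) / sqrt a
    | Suc j' \<Rightarrow> (case i of 0 \<Rightarrow> 0 | Suc i' \<Rightarrow> L $$ (i', j')))"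
  have "A = N * transpose_mat N"
  proof (rule eq_matI)
    fix i j assume "i < dim_row (N * transpose_mat N)" "j < dim_col (N * transpose_mat N)"
    then have ij: "i < Suc q" "j < Suc q" by (auto simp: N_def)
    then have "(N * transpose_mat N) $$ (i, j) = (\<Sum>k<Suc q. N $$ (i, k) * N $$ (j, k))"
      by (simp add: N_def scalar_prod_def atLeast0LessThan del: sum.lessThan_Suc)
    also have "\<dots> = A $$ (i, j)"
      using ij a
      by (cases i; cases j)
        (auto simp: sum.lessThan_Suc_shift N_def BL' sym simp flip: a_def simp del: sum.lessThan_Suc)
    finally show "A $$ (i, j) = (N * transpose_mat N) $$ (i, j)" by simp
  qed (use A in \<open>auto simp: N_def\<close>)
  moreover have "N $$ (i, j) = 0" if "i < Suc q" "j < Suc q" "i < j" for i j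
    using that low by (cases i; cases j) (auto simp: N_def)
  moreover have "0 < N $$ (i, i)" if "i < Suc q" for i
    using that diag a by (cases i) (auto simp: N_def simp flip: a_def)
  moreover have "N \<in> carrier_mat (Suc q) (Suc q)" by (simp add: N_def)
  ultimately show ?case by blast
qed

lemma det_lower_triangular_prod:
  assumes "L \<in> carrier_mat q q" "\<forall>i<q. \<forall>j<q. i < j \<longrightarrow> L $$ (i, j) = (0::real)"
  shows "det L = (\<Prod>i<q. L $$ (i, i))"
proof -
  have "det L = prod_list (diag_mat L)"
    using assms by (intro det_lower_triangular) auto
  then show ?thesis
    using assms(1) by (simp add: prod_list_diag_prod atLeast0LessThan)
qed

text \<open>The Cholesky factor is invertible because its diagonal is positive. Keeping
  \<open>R\<close> next to \<open>L\<close> allows a congruence by \<open>L\<close> to be undone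
  explicitly.\<close>

lemma pos_def_mat_factor:
  assumes "pos_def_mat q A"
  obtains L R where "L \<in> carrier_mat q q" "R \<in> carrier_mat q q" "L * R = 1\<^sub>m q" "R * L = 1\<^sub>m q"
    "A = L * transpose_mat L"
proof -
  obtain L where L: "L \<in> carrier_mat q q" "\<forall>i<q. \<forall>j<q. i < j \<longrightarrow> L $$ (i, j) = 0"
    "\<forall>i<q. 0 < L $$ (i, i)" "A = L * transpose_mat L"
    using cholesky[OF assms] by blast
  have "det L \<noteq> 0"
    using L(3) by (auto simp: det_lower_triangular_prod[OF L(1,2)])
  with L(1) obtain R where "R \<in> carrier_mat q q" "L * R = 1\<^sub>m q" "R * L = 1\<^sub>m q"
    by (rule det_nonzero_inverse)
  with L that show ?thesis by blast
qed

lemma pos_def_mat_inverse: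
  assumes A: "pos_def_mat q A"
  shows "pos_def_mat q (mat_inv A)" "mat_inv A * A = 1\<^sub>m q" "A * mat_inv A = 1\<^sub>m q"
    "0 < det A" "det (mat_inv A) = 1 / det A"
proof -
  obtain L R where LR: "L \<in> carrier_mat q q" "R \<in> carrier_mat q q" "L * R = 1\<^sub>m q"
    "R * L = 1\<^sub>m q" "A = L * transpose_mat L"
    using A by (rule pos_def_mat_factor)
  have RLt: "transpose_mat L * transpose_mat R = 1\<^sub>m q" "transpose_mat R * transpose_mat L = 1\<^sub>m q"
    using LR by (simp_all add: transpose_mult_eq_1)
  \<comment> \<open>Inverting the factors of \<open>A\<close> in reverse order gives the candidate
    inverse, which is itself a Gram matrix and hence positive definite.\<close>
  have "A * (transpose_mat R * R) = L * (transpose_mat L * (transpose_mat R * R))"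
    using LR by (simp add: assoc_mult_mat[of _ q q _ q _ q])
  also have "transpose_mat L * (transpose_mat R * R) = R"
    using LR RLt by (subst assoc_mult_mat[of _ q q _ q _ q, symmetric]) auto
  finally have 1: "A * (transpose_mat R * R) = 1\<^sub>m q" using LR by simp
  have Ac: "A \<in> carrier_mat q q" using LR by simp
  have inv: "mat_inv A = transpose_mat R * R"
    using LR 1 by (intro mat_inv_unique) auto
  show "pos_def_mat q (mat_inv A)"
    using pos_def_mat_gram[of "transpose_mat R" q "transpose_mat L"] LR RLt inv by simp
  show AI: "A * mat_inv A = 1\<^sub>m q" using 1 inv by simp
  show "mat_inv A * A = 1\<^sub>m q"
    using LR(2) inv by (intro mat_mult_left_right_inverse[OF Ac _ AI]) simp
  have "det L * det R = 1" using det_mult[OF LR(1,2)] LR(3) by simp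
  then have "0 < det L * det L" by (metis mult_zero_left not_real_square_gt_zero zero_neq_one)
  then show "0 < det A"
    unfolding LR(5) using LR(1) by (simp add: det_mult[of _ q] det_transpose[of _ q])
  moreover have "det A * det (mat_inv A) = 1"
    using det_mult[OF Ac, of "mat_inv A"] AI LR(2) inv by simp
  ultimately show "det (mat_inv A) = 1 / det A" by (simp add: field_simps)
qed

section \<open>The trace-determinant inequality and its equality case\<close>

lemma mat_trace_mult_comm:
  assumes "A \<in> carrier_mat q q" "B \<in> carrier_mat q q"
  shows "mat_trace (A * B) = mat_trace (B * A)"
proof -
  have "mat_trace (A * B) = (\<Sum>i<q. \<Sum>j<q. A $$ (i, j) * B $$ (j, i))"
    using assms by (simp add: mat_trace_def scalar_prod_def atLeast0LessThan)
  also have "\<dots> = (\<Sum>j<q. \<Sum>i<q. B $$ (j, i) * A $$ (i, j))"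
    by (subst sum.swap) (simp add: mult.commute)
  also have "\<dots> = mat_trace (B * A)"
    using assms by (simp add: mat_trace_def scalar_prod_def atLeast0LessThan)
  finally show ?thesis .
qed

text \<open>For a Cholesky factor \<open>L\<close> of \<open>B\<close>, the difference of the two
  sides is the sum of the squared off-diagonal entries of \<open>L\<close> over \<open>c\<close>,
  plus the terms d - 1 - ln d with d a squared diagonal entry over \<open>c\<close>. All are
  nonnegative, and d - 1 = ln d only for d = 1; so equality makes \<open>L\<close> diagonal with
  squared diagonal entries \<open>c\<close>.\<close>

lemma mat_trace_ge_ln_det:
  assumes B: "pos_def_mat q B" and c: "0 < c"
  shows "real q + ln (det B / c ^ q) \<le> mat_trace B / c"
    and "mat_trace B / c = real q + ln (det B / c ^ q) \<Longrightarrow> B = c \<cdot>\<^sub>m 1\<^sub>m q"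
proof -
  obtain L where L: "L \<in> carrier_mat q q" and low: "\<forall>i<q. \<forall>j<q. i < j \<longrightarrow> L $$ (i, j) = 0"
    and diag: "\<forall>i<q. 0 < L $$ (i, i)" and BL: "B = L * transpose_mat L"
    using cholesky[OF B] by blast
  define d where "d i = (L $$ (i, i))\<^sup>2 / c" for i
  have d: "0 < d i" if "i < q" for i using that diag c by (auto simp: d_def)
  define off where "off i j = (if i = j then 0 else (L $$ (i, j))\<^sup>2 / c)" for i j
  have off: "0 \<le> off i j" for i j using c by (simp add: off_def)
  have gap: "0 \<le> d i - 1 - ln (d i)" if "i < q" for i
    using ln_le_minus_one[OF d[OF that]] by simp
  have "det B = (\<Prod>i<q. (L $$ (i, i))\<^sup>2)"
    unfolding BL using L low
    by (simp add: det_mult[of _ q] det_transpose[of _ q] det_lower_triangular_prod power2_eq_square prod.distrib)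
  then have "ln (det B / c ^ q) = ln (\<Prod>i<q. d i)"
    by (simp add: d_def prod_dividef)
  also have "\<dots> = (\<Sum>i<q. ln (d i))"
    by (intro ln_prod) (auto simp: less_imp_neq[OF d, symmetric])
  finally have ld: "ln (det B / c ^ q) = (\<Sum>i<q. ln (d i))" .
  have "mat_trace B / c = (\<Sum>i<q. \<Sum>j<q. (L $$ (i, j))\<^sup>2 / c)"
    using L BL
    by (simp add: mat_trace_def scalar_prod_def atLeast0LessThan sum_divide_distrib power2_eq_square)
  also have "\<dots> = (\<Sum>i<q. \<Sum>j<q. off i j + (if i = j then d i else 0))"
    by (intro sum.cong) (auto simp: off_def d_def)
  also have "\<dots> = (\<Sum>i<q. \<Sum>j<q. off i j) + (\<Sum>i<q. d i)"
    by (simp add: sum.distrib)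
  finally have tr: "mat_trace B / c - real q - ln (det B / c ^ q)
      = (\<Sum>i<q. (\<Sum>j<q. off i j) + (d i - 1 - ln (d i)))"
    by (simp add: ld sum.distrib sum_subtractf)
  have nonneg: "0 \<le> (\<Sum>j<q. off i j) + (d i - 1 - ln (d i))" if "i < q" for i
    using gap[OF that] off by (simp add: sum_nonneg)
  show "real q + ln (det B / c ^ q) \<le> mat_trace B / c"
    using sum_nonneg[of "{..<q}" "\<lambda>i. (\<Sum>j<q. off i j) + (d i - 1 - ln (d i))"] tr nonneg
    by simp
  assume "mat_trace B / c = real q + ln (det B / c ^ q)"
  then have "\<forall>i\<in>{..<q}. (\<Sum>j<q. off i j) + (d i - 1 - ln (d i)) = 0"
    using tr nonneg by (subst sum_nonneg_eq_0_iff[symmetric]) auto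
  then have zero: "(\<Sum>j<q. off i j) = 0" "d i - 1 - ln (d i) = 0" if "i < q" for i
    using that gap[OF that] sum_nonneg[of "{..<q}" "off i"] off by (smt (verit) lessThan_iff)+
  have "L $$ (i, j) = 0" if "i < q" "j < q" "i \<noteq> j" for i j
  proof -
    have "\<forall>j\<in>{..<q}. off i j = 0"
      using zero(1)[OF that(1)] off by (subst sum_nonneg_eq_0_iff[symmetric]) auto
    with that c show ?thesis by (force simp: off_def split: if_splits)
  qed
  moreover have "(L $$ (i, i))\<^sup>2 = c" if "i < q" for i
    using ln_eq_minus_one[OF d[OF that]] zero(2)[OF that] c by (simp add: d_def)
  ultimately have "L $$ (i, k) * L $$ (j, k) = (if k = i then if i = j then c else 0 else 0)"
    if "i < q" "j < q" "k < q" for i j k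
    using that by (auto simp: power2_eq_square)
  then show "B = c \<cdot>\<^sub>m 1\<^sub>m q"
    using L BL by (intro eq_matI) (auto simp: scalar_prod_def atLeast0LessThan)
qed

text \<open>With \<open>A = L L\<^sup>T\<close>, the trace of \<open>S A\<close> is the trace of the positive definite matrix
  \<open>L\<^sup>T S L\<close>, whose determinant is that of \<open>A\<close>.\<close>

lemma mat_trace_mult_ge:
  assumes S: "pos_def_mat q S" "det S = 1" and A: "pos_def_mat q A" and q: "0 < q"
  shows "real q * det A powr (1 / real q) \<le> mat_trace (S * A)"
    and "mat_trace (S * A) = real q * det A powr (1 / real q)
      \<longleftrightarrow> S = det A powr (1 / real q) \<cdot>\<^sub>m mat_inv A"
proof -
  \<comment> \<open>This scale satisfies \<open>c ^ q = det A = det B\<close>, so the logarithm in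
    \<open>mat_trace_ge_ln_det\<close> vanishes and the bound reads
    \<open>q \<le> mat_trace B / c\<close>.\<close>
  define c where "c = det A powr (1 / real q)"
  have dA: "0 < det A" using pos_def_mat_inverse(4)[OF A] .
  then have c: "0 < c" by (simp add: c_def)
  have cq: "c ^ q = det A"
    using q dA by (simp add: c_def powr_power)
  obtain L R where LR: "L \<in> carrier_mat q q" "R \<in> carrier_mat q q" "L * R = 1\<^sub>m q"
    "R * L = 1\<^sub>m q" "A = L * transpose_mat L"
    using A by (rule pos_def_mat_factor)
  have Sc: "S \<in> carrier_mat q q" using S by (simp add: pos_def_mat_def)
  have Ac: "A \<in> carrier_mat q q" using A by (simp add: pos_def_mat_def)
  have RLt: "transpose_mat L * transpose_mat R = 1\<^sub>m q" "transpose_mat R * transpose_mat L = 1\<^sub>m q"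
    using LR by (simp_all add: transpose_mult_eq_1)
  define B where "B = transpose_mat L * S * L"
  have B: "pos_def_mat q B"
    using pos_def_mat_congruence[OF S(1), of "transpose_mat L" "transpose_mat R"] LR RLt
    by (simp add: B_def)
  have dB: "det B = det A"
    using LR Sc S(2) by (simp add: B_def det_mult[of _ q] det_transpose)
  have "mat_trace (S * A) = mat_trace ((S * L) * transpose_mat L)"
    using LR Sc by (simp add: assoc_mult_mat[of _ q q _ q _ q])
  also have "\<dots> = mat_trace B"
    using LR Sc by (subst mat_trace_mult_comm[of _ q]) (auto simp: B_def assoc_mult_mat[of _ q q _ q _ q])
  finally have tr: "mat_trace (S * A) = mat_trace B" .
  show "real q * det A powr (1 / real q) \<le> mat_trace (S * A)"
    using mat_trace_ge_ln_det(1)[OF B c] dA c tr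
    by (simp add: dB cq pos_le_divide_eq flip: c_def)
  have "S = c \<cdot>\<^sub>m mat_inv A" if "mat_trace (S * A) = real q * c"
  proof -
    have "mat_trace B / c = real q" using that tr c by simp
    then have Bc: "B = c \<cdot>\<^sub>m 1\<^sub>m q"
      using mat_trace_ge_ln_det(2)[OF B c] dA by (simp add: dB cq)
    \<comment> \<open>Undoing the congruence on the left turns the equality case
      \<open>B = c \<cdot>\<^sub>m 1\<^sub>m q\<close> into a formula for \<open>S * A\<close>, from
      which \<open>S\<close> is read off.\<close>
    have SL: "S * L = transpose_mat R * B"
    proof -
      have "transpose_mat R * B = (transpose_mat R * transpose_mat L) * (S * L)"
        using LR Sc by (simp add: B_def assoc_mult_mat[of _ q q _ q _ q])
      then show ?thesis using RLt LR Sc by simp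
    qed
    have "S * A = (S * L) * transpose_mat L"
      using LR Sc by (simp add: assoc_mult_mat[of _ q q _ q _ q])
    also have "\<dots> = (c \<cdot>\<^sub>m transpose_mat R) * transpose_mat L"
      unfolding SL Bc using LR
      by (subst mult_smult_distrib[of _ q q]) auto
    also have "\<dots> = c \<cdot>\<^sub>m 1\<^sub>m q"
      using LR RLt by (subst mult_smult_assoc_mat[of _ q q]) auto
    finally have SA: "S * A = c \<cdot>\<^sub>m 1\<^sub>m q" .
    have I: "mat_inv A \<in> carrier_mat q q"
      using pos_def_mat_inverse(1)[OF A] by (simp add: pos_def_mat_def)
    have "S = S * (A * mat_inv A)"
      using Sc pos_def_mat_inverse(3)[OF A] by simp
    also have "\<dots> = (S * A) * mat_inv A"
      using Sc Ac I by (simp add: assoc_mult_mat[of _ q q _ q _ q])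
    also have "\<dots> = c \<cdot>\<^sub>m mat_inv A"
      unfolding SA using I by (subst mult_smult_assoc_mat[of _ q q]) auto
    finally show ?thesis .
  qed
  moreover have "mat_trace (S * A) = real q * c" if "S = c \<cdot>\<^sub>m mat_inv A"
  proof -
    have "S * A = c \<cdot>\<^sub>m 1\<^sub>m q"
      using that Ac pos_def_mat_inverse(1,2)[OF A]
      by (simp add: pos_def_mat_def mult_smult_assoc_mat[of _ q q])
    then show ?thesis by (simp add: mat_trace_def)
  qed
  ultimately show "mat_trace (S * A) = real q * det A powr (1 / real q)
      \<longleftrightarrow> S = det A powr (1 / real q) \<cdot>\<^sub>m mat_inv A"
    unfolding c_def by blast
qed

section \<open>Inverses of singular and scaled matrices, null sets of densities, expectations of
  matrices\<close>

lemma mat_inv_singular: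
  assumes "A \<in> carrier_mat q q" "det A = 0"
  shows "mat_inv A = the None"
proof (cases "mat_inverse A")
  case (Some B)
  then have "A * B = 1\<^sub>m q" "B \<in> carrier_mat q q"
    using mat_inverse(2)[OF assms(1)] by auto
  then show ?thesis
    using det_mult[OF assms(1), of B] assms(2) by simp
qed (simp add: mat_inv_def)

lemma mat_inv_smult:
  assumes A: "A \<in> carrier_mat q q" and "det A \<noteq> 0" "c \<noteq> 0"
  shows "mat_inv (c \<cdot>\<^sub>m A) = (1 / c) \<cdot>\<^sub>m mat_inv A"
proof -
  obtain B where B: "B \<in> carrier_mat q q" "A * B = 1\<^sub>m q"
    using det_nonzero_inverse[OF A assms(2)] by blast
  then have "(c \<cdot>\<^sub>m A) * ((1 / c) \<cdot>\<^sub>m B) = (1 / c) \<cdot>\<^sub>m (c \<cdot>\<^sub>m (A * B))"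
    using A by (simp add: mult_smult_distrib[of _ q q] mult_smult_assoc_mat[of _ q q])
  also have "\<dots> = 1\<^sub>m q"
    using assms B by (intro eq_matI) auto
  finally show ?thesis
    using A B mat_inv_unique[OF A B] by (auto intro!: mat_inv_unique[of _ q])
qed

text \<open>No measurability of \<^term>\<open>f\<close> is needed: a density that fails to be a measure is the
  zero measure.\<close>

lemma AE_density_nonzero:
  assumes N: "{x \<in> space M. P x} \<in> sets M" and f: "\<And>x. x \<in> space M \<Longrightarrow> P x \<Longrightarrow> f x = 0"
  shows "AE x in density M f. \<not> P x"
proof (rule AE_I')
  have "(\<integral>\<^sup>+ x. f x * indicator {x \<in> space M. P x} x \<partial>M) = (\<integral>\<^sup>+ x. 0 \<partial>M)"
    using f by (intro nn_integral_cong) (auto simp: indicator_def)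
  then have "emeasure (density M f) {x \<in> space M. P x} = 0"
    by (simp add: density_def emeasure_measure_of_conv)
  then show "{x \<in> space M. P x} \<in> null_sets (density M f)"
    using N by (simp add: null_sets_def)
qed simp

lemma mat_trace_transpose_mult:
  assumes "A \<in> carrier_mat q q" "B \<in> carrier_mat q q"
  shows "mat_trace (transpose_mat A * B) = (\<Sum>i<q. \<Sum>j<q. A $$ (j, i) * B $$ (j, i))"
  using assms by (simp add: mat_trace_def scalar_prod_def atLeast0LessThan)

lemma integral_double_sum:
  fixes f :: "'b \<Rightarrow> 'c \<Rightarrow> 'a \<Rightarrow> real"
  assumes "\<And>i j. i \<in> I \<Longrightarrow> j \<in> J \<Longrightarrow> integrable M (f i j)"
  shows "(\<integral>w. (\<Sum>i\<in>I. \<Sum>j\<in>J. f i j w) \<partial>M) = (\<Sum>i\<in>I. \<Sum>j\<in>J. \<integral>w. f i j w \<partial>M)"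
  using assms by (simp add: Bochner_Integration.integral_sum Bochner_Integration.integrable_sum)

text \<open>A quadratic form is linear in the matrix, so the form of the mean is the mean of the
  forms. It stays strictly positive because an almost surely positive integrable function has
  positive integral over a space of mass 1.\<close>

lemma pos_def_mat_expectation:
  assumes "prob_space M"
    and int: "\<And>i j. i < q \<Longrightarrow> j < q \<Longrightarrow> integrable M (\<lambda>w. F w $$ (i, j))"
    and pd: "AE w in M. pos_def_mat q (F w)"
  shows "pos_def_mat q (mat_expectation M q F)"
proof -
  interpret prob_space M by fact
  let ?A = "mat_expectation M q F"
  have A: "?A \<in> carrier_mat q q" by (simp add: mat_expectation_def)
  have "transpose_mat ?A = ?A"
  proof (rule eq_matI)
    fix i j assume "i < dim_row ?A" "j < dim_col ?A"
    then have ij: "i < q" "j < q" using A by auto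
    have "(\<integral>w. F w $$ (j, i) \<partial>M) = (\<integral>w. F w $$ (i, j) \<partial>M)"
    proof (rule integral_cong_AE)
      show "AE w in M. F w $$ (j, i) = F w $$ (i, j)"
        using pd
      proof eventually_elim
        case (elim w)
        then have "F w \<in> carrier_mat q q" "transpose_mat (F w) = F w"
          by (auto simp: pos_def_mat_def)
        then show ?case using ij by (metis carrier_matD index_transpose_mat(1))
      qed
    qed (use int ij in auto)
    then show "transpose_mat ?A $$ (i, j) = ?A $$ (i, j)"
      using ij by (simp add: mat_expectation_def)
  qed (use A in auto)
  moreover have "0 < scalar_prod v (?A *\<^sub>v v)" if v: "v \<in> carrier_vec q" "v \<noteq> 0\<^sub>v q" for v
  proof -
    let ?f = "\<lambda>w. \<Sum>i<q. \<Sum>j<q. v $ i * F w $$ (i, j) * v $ j"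
    have f: "integrable M ?f"
      using int by (intro Bochner_Integration.integrable_sum integrable_mult_left integrable_mult_right) auto
    have "AE w in M. 0 < ?f w"
      using pd
    proof eventually_elim
      case (elim w)
      then have "F w \<in> carrier_mat q q" "0 < scalar_prod v (F w *\<^sub>v v)"
        using v by (auto simp: pos_def_mat_def)
      then show ?case using v by (simp add: quadratic_form_sum)
    qed
    then have "(\<integral>w. 0 \<partial>M) < (\<integral>w. ?f w \<partial>M)"
      using f by (intro integral_less_AE_space) (auto simp: emeasure_space_1)
    also have "\<dots> = (\<Sum>i<q. \<Sum>j<q. v $ i * ?A $$ (i, j) * v $ j)"
      using int by (subst integral_double_sum) (auto simp: mat_expectation_def)
    also have "\<dots> = scalar_prod v (?A *\<^sub>v v)"
      using A v by (simp add: quadratic_form_sum)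
    finally show ?thesis by simp
  qed
  ultimately show ?thesis using A by (simp add: pos_def_mat_def)
qed

text \<open>In the variable y = x D / K the excess over the minimum is K (y - 1 - ln y), which is
  nonnegative and vanishes only at y = 1.\<close>

lemma linear_minus_ln_ge:
  fixes x D K :: real
  assumes "0 < x" "0 < D" "0 < K"
  shows "K - K * ln (K / D) \<le> x * D - K * ln x"
    and "x * D - K * ln x = K - K * ln (K / D) \<longleftrightarrow> x = K / D"
proof -
  define y where "y = x * D / K"
  have y: "0 < y" using assms by (simp add: y_def)
  have lnx: "ln x = ln y + ln (K / D)"
    using assms by (simp add: y_def ln_div ln_mult)
  have xD: "x * D = K * y" using assms(3) by (simp add: y_def)
  have gap: "x * D - K * ln x - (K - K * ln (K / D)) = K * (y - 1 - ln y)"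
    unfolding lnx xD by (simp add: algebra_simps)
  have "0 \<le> y - 1 - ln y" using ln_le_minus_one[OF y] by simp
  then have "0 \<le> K * (y - 1 - ln y)" using assms(3) by simp
  with gap show "K - K * ln (K / D) \<le> x * D - K * ln x" by linarith
  have "x * D - K * ln x = K - K * ln (K / D) \<longleftrightarrow> K * (y - 1 - ln y) = 0"
    unfolding gap[symmetric] by linarith
  also have "\<dots> \<longleftrightarrow> y = 1"
    using assms(3) ln_eq_minus_one[OF y] by auto
  also have "\<dots> \<longleftrightarrow> x = K / D"
    using assms by (auto simp: y_def field_simps)
  finally show "x * D - K * ln x = K - K * ln (K / D) \<longleftrightarrow> x = K / D" .
qed

section \<open>The matrices of the model and the support of the posterior\<close>

lemma Psi_carrier [simp]: "Psi p w k \<in> carrier_mat (p k) (p k)"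
  by (simp add: Psi_def)

lemma Sig_carrier [simp]: "Sig p w k \<in> carrier_mat (p k) (p k)"
  by (simp add: Sig_def mult_carrier_mat[of _ _ "p k"])

text \<open>The two products are left uncancelled because \<open>inverse 0 = 0\<close>: the
  determinant is 1 when all these coordinates are nonzero and 0 otherwise. In this form it is
  visibly measurable on the whole parameter space.\<close>

lemma det_Psi:
  assumes "1 \<le> p k"
  shows "det (Psi p w k) = (\<Prod>l = 1..<p k. inverse (snd w (k, l, l))) * (\<Prod>l = 1..<p k. snd w (k, l, l))"
proof -
  have "det (Psi p w k) = (\<Prod>i<p k. Psi p w k $$ (i, i))"
    by (intro det_lower_triangular_prod) (auto simp: Psi_def)
  also have "\<dots> = Psi p w k $$ (0, 0) * (\<Prod>i = 1..<p k. Psi p w k $$ (i, i))"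
    using assms by (simp add: prod.atLeast_Suc_lessThan flip: atLeast0LessThan)
  also have "(\<Prod>i = 1..<p k. Psi p w k $$ (i, i)) = (\<Prod>l = 1..<p k. snd w (k, l, l))"
    by (intro prod.cong) (auto simp: Psi_def)
  finally show ?thesis using assms by (simp add: Psi_def)
qed

lemma det_Sig: "det (Sig p w k) = (det (Psi p w k))\<^sup>2"
  by (simp add: Sig_def det_mult[of _ "p k"] det_transpose[of _ "p k"] power2_eq_square)

lemma precision_pos_def:
  assumes "0 < sig w" "det (Psi p w k) \<noteq> 0"
  shows "pos_def_mat (p k) (precision p w k)"
proof -
  obtain R where "R \<in> carrier_mat (p k) (p k)" "Psi p w k * R = 1\<^sub>m (p k)"
    using det_nonzero_inverse[OF Psi_carrier assms(2)] by blast
  then have "pos_def_mat (p k) (Sig p w k)"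
    unfolding Sig_def by (intro pos_def_mat_gram) auto
  then have "pos_def_mat (p k) ((sig w)\<^sup>2 \<cdot>\<^sub>m Sig p w k)"
    using assms(1) by (intro pos_def_mat_smult) auto
  then show ?thesis unfolding precision_def by (rule pos_def_mat_inverse)
qed

lemma component_measurable:
  assumes "k \<in> {1..K}" "l \<in> {1..<p k}"
  shows "(\<lambda>w. snd w (k, l, l)) \<in> borel_measurable (param_lebesgue K p)"
proof -
  have "(k, l, l) \<in> coord_idx K p" using assms by (auto simp: coord_idx_def)
  then have "(\<lambda>x. x (k, l, l)) \<in> borel_measurable (\<Pi>\<^sub>M c \<in> coord_idx K p. lborel)"
    using measurable_component_singleton[of "(k, l, l)" "coord_idx K p" "\<lambda>_. lborel"] by simp
  then show ?thesis
    unfolding param_lebesgue_def by (rule measurable_compose[OF measurable_snd])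
qed

lemma sig_measurable: "sig \<in> borel_measurable (param_lebesgue K p)"
  unfolding sig_def[abs_def] param_lebesgue_def
  using measurable_fst[of "lborel :: real measure"] by (simp cong: measurable_cong_sets)

lemma det_Psi_measurable:
  assumes "k \<in> {1..K}" "1 \<le> p k"
  shows "(\<lambda>w. det (Psi p w k)) \<in> borel_measurable (param_lebesgue K p)"
  unfolding det_Psi[of p, OF assms(2)]
  using component_measurable[of k K _ p] assms
  by (intro borel_measurable_times borel_measurable_prod borel_measurable_inverse) auto

text \<open>The kernel vanishes unless \<open>sig w\<close> is positive and every
  \<open>Psi p w k\<close> lies in \<open>Gplus\<close>, where the determinant is 1. What is
  extracted from this is exactly what \<open>precision_pos_def\<close> asks for.\<close>

lemma posterior_AE:
  assumes "is_posterior K p n X M" and p: "\<And>k. k \<in> {1..K} \<Longrightarrow> 1 \<le> p k"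
  shows "AE w in M. 0 < sig w \<and> (\<forall>k\<in>{1..K}. det (Psi p w k) \<noteq> 0)"
proof -
  obtain c where M: "M = density (param_lebesgue K p) (\<lambda>w. ennreal (c * post_kernel K p n X w))"
    using assms by (auto simp: is_posterior_def)
  have "AE w in M. \<not> sig w \<le> 0"
    unfolding M
  proof (intro AE_density_nonzero)
    show "{w \<in> space (param_lebesgue K p). sig w \<le> 0} \<in> sets (param_lebesgue K p)"
      by (rule borel_measurable_le[OF sig_measurable borel_measurable_const])
  qed (simp add: post_kernel_def)
  moreover have "AE w in M. \<forall>k\<in>{1..K}. \<not> det (Psi p w k) = 0"
  proof (intro AE_ball_countable[THEN iffD2] ballI)
    fix k assume k: "k \<in> {1..K}"
    show "AE w in M. \<not> det (Psi p w k) = 0"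
      unfolding M
    proof (intro AE_density_nonzero)
      show "{w \<in> space (param_lebesgue K p). det (Psi p w k) = 0} \<in> sets (param_lebesgue K p)"
        by (rule borel_measurable_eq[OF det_Psi_measurable[of k K p, OF k p[OF k]] borel_measurable_const])
      fix w assume "det (Psi p w k) = 0"
      then have "Psi p w k \<notin> Gplus (p k)" by (auto simp: Gplus_def)
      then show "ennreal (c * post_kernel K p n X w) = 0"
        using k by (auto simp: post_kernel_def)
    qed
  qed auto
  ultimately show ?thesis by eventually_elim auto
qed

section \<open>The posterior risk as a function of s and the matrices S_k\<close>

locale integrable_posterior =
  fixes K n :: nat and p :: "nat \<Rightarrow> nat" and X :: "nat list \<Rightarrow> real" and M :: "param measure"
  assumes K: "1 \<le> K" and p: "\<And>k. k \<in> {1..K} \<Longrightarrow> 1 \<le> p k"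
    and posterior: "is_posterior K p n X M"
    and integrable_precision: "\<And>k i j. k \<in> {1..K} \<Longrightarrow> i < p k \<Longrightarrow> j < p k \<Longrightarrow>
           integrable M (\<lambda>w. precision p w k $$ (i, j))"
    and integrable_ln_sig: "integrable M (\<lambda>w. ln (sig w))"
begin

sublocale prob_space M
  using posterior by (simp add: is_posterior_def)

abbreviation "mean_precision k \<equiv> mat_expectation M (p k) (\<lambda>w. precision p w k)"

lemma measurable_M: "borel_measurable M = borel_measurable (param_lebesgue K p)"
  using posterior by (auto simp: is_posterior_def intro!: measurable_cong_sets)

lemma AE_regular: "AE w in M. 0 < sig w \<and> (\<forall>k\<in>{1..K}. det (Psi p w k) \<noteq> 0)"
  using posterior p by (rule posterior_AE)

lemma mean_precision_pos_def:
  assumes k: "k \<in> {1..K}"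
  shows "pos_def_mat (p k) (mean_precision k)"
proof (rule pos_def_mat_expectation[OF prob_space_axioms integrable_precision[OF k]])
  show "AE w in M. pos_def_mat (p k) (precision p w k)"
    using AE_regular by eventually_elim (use k precision_pos_def in blast)
qed

text \<open>This makes the trace term of the loss linear in the entries of \<open>precision\<close>,
  the quantities whose integrability is assumed.\<close>

lemma scaled_trace_eq:
  assumes "S \<in> carrier_mat (p k) (p k)" "sig w \<noteq> 0" "det (Psi p w k) \<noteq> 0"
  shows "1 / (sig w)\<^sup>2 * mat_trace (transpose_mat S * mat_inv (Sig p w k))
    = (\<Sum>i<p k. \<Sum>j<p k. S $$ (j, i) * precision p w k $$ (j, i))"
proof -
  have d: "det (Sig p w k) \<noteq> 0" using assms by (simp add: det_Sig)
  obtain B where "B \<in> carrier_mat (p k) (p k)" "Sig p w k * B = 1\<^sub>m (p k)"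
    using det_nonzero_inverse[OF Sig_carrier d] by blast
  then have B: "mat_inv (Sig p w k) \<in> carrier_mat (p k) (p k)"
    using mat_inv_unique[OF Sig_carrier] by auto
  have "precision p w k = (1 / (sig w)\<^sup>2) \<cdot>\<^sub>m mat_inv (Sig p w k)"
    unfolding precision_def using assms(2) d by (intro mat_inv_smult[OF Sig_carrier]) auto
  then show ?thesis
    using B mat_trace_transpose_mult[OF assms(1) B] by (simp add: sum_distrib_left mult_ac)
qed

text \<open>Where \<open>\<Psi>\<^sub>k\<close> is singular, \<^const>\<open>mat_inv\<close> takes one fixed junk value; so measurability
  of the loss follows from that of the precision entries alone.\<close>

lemma loss_measurable:
  assumes S: "\<And>k. k \<in> {1..K} \<Longrightarrow> S k \<in> carrier_mat (p k) (p k)"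
  shows "(\<lambda>w. loss K p w s S) \<in> borel_measurable M"
proof -
  \<comment> \<open>The three cases mirror the conventions: division by zero gives 0, a singular
    matrix gives a fixed matrix divided by \<open>(sig w)\<^sup>2\<close>, and otherwise the linear
    expression applies. Each case is measurable, and so are the conditions that separate
    them.\<close>
  define g where "g k w = (if sig w = 0 then 0
    else if det (Psi p w k) = 0 then 1 / (sig w)\<^sup>2 * mat_trace (transpose_mat (S k) * the None)
    else (\<Sum>i<p k. \<Sum>j<p k. S k $$ (j, i) * precision p w k $$ (j, i)))" for k w
  have g: "1 / (sig w)\<^sup>2 * mat_trace (transpose_mat (S k) * mat_inv (Sig p w k)) = g k w"
    if "k \<in> {1..K}" for k w
  proof (cases "det (Psi p w k) = 0")
    case True
    then have "mat_inv (Sig p w k) = the None"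
      by (intro mat_inv_singular[OF Sig_carrier]) (simp add: det_Sig)
    with True show ?thesis by (simp add: g_def)
  next
    case False
    then show ?thesis
      using scaled_trace_eq[OF S[OF that], of w] by (cases "sig w = 0") (simp_all add: g_def)
  qed
  have sm [measurable]: "sig \<in> borel_measurable M"
    using sig_measurable[of K p] unfolding measurable_M .
  have gm: "g k \<in> borel_measurable M" if k: "k \<in> {1..K}" for k
  proof -
    have [measurable]: "(\<lambda>w. det (Psi p w k)) \<in> borel_measurable M"
      using det_Psi_measurable[of k K p, OF k p[OF k]] unfolding measurable_M .
    have [measurable]: "(\<lambda>w. \<Sum>i<p k. \<Sum>j<p k. S k $$ (j, i) * precision p w k $$ (j, i))
        \<in> borel_measurable M"
      using integrable_precision[OF k]
      by (intro borel_measurable_sum borel_measurable_times) auto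
    show ?thesis unfolding g_def[abs_def] by measurable
  qed
  have "loss K p w s S = s\<^sup>2 * (\<Sum>k = 1..K. real (total_dim K p) / real (p k) * g k w)
     - real K * real (total_dim K p) * ln (s\<^sup>2 / (sig w)\<^sup>2) - real K * real (total_dim K p)" for w
  proof -
    have "(\<Sum>k = 1..K. real (total_dim K p) / real (p k) * g k w) = 1 / (sig w)\<^sup>2 *
       (\<Sum>k = 1..K. real (total_dim K p) / real (p k) *
        mat_trace (transpose_mat (S k) * mat_inv (Sig p w k)))"
      unfolding sum_distrib_left by (intro sum.cong) (simp_all add: g[symmetric])
    then show ?thesis unfolding loss_def by simp
  qed
  moreover have "(\<lambda>w. \<Sum>k = 1..K. real (total_dim K p) / real (p k) * g k w) \<in> borel_measurable M"
    using gm by (intro borel_measurable_sum borel_measurable_times) auto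
  ultimately show ?thesis by simp
qed

text \<open>Splitting the logarithm leaves \<open>sig\<close> only in the linear trace terms and in
  \<open>ln (sig w)\<close>. Both are integrable, so the risk is a genuine expectation rather than
  the default value of a divergent integral, and the mean of \<open>ln (sig w)\<close> is a constant
  independent of \<open>s\<close> and \<open>S\<close>.\<close>

lemma post_risk_eq:
  assumes S: "admissible K p s S"
  shows "post_risk K p M s S = real (total_dim K p) *
     (s\<^sup>2 * (\<Sum>k = 1..K. mat_trace (S k * mean_precision k) / real (p k)) - real K * ln (s\<^sup>2)
      + real K * (2 * (\<integral>w. ln (sig w) \<partial>M) - 1))"
proof -
  let ?P = "real (total_dim K p)"
  have s: "0 < s" and Sc: "\<And>k. k \<in> {1..K} \<Longrightarrow> S k \<in> carrier_mat (p k) (p k)"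
    and St: "\<And>k. k \<in> {1..K} \<Longrightarrow> transpose_mat (S k) = S k"
    using S by (auto simp: admissible_def pos_def_mat_def)
  define f where "f k w = (\<Sum>i<p k. \<Sum>j<p k. S k $$ (j, i) * precision p w k $$ (j, i))" for k w
  have f: "integrable M (f k)" if "k \<in> {1..K}" for k
    unfolding f_def[abs_def] using integrable_precision[OF that]
    by (intro Bochner_Integration.integrable_sum integrable_mult_right) auto
  have If: "(\<integral>w. f k w \<partial>M) = mat_trace (S k * mean_precision k)" if k: "k \<in> {1..K}" for k
  proof -
    have "(\<integral>w. f k w \<partial>M) = (\<Sum>i<p k. \<Sum>j<p k. S k $$ (j, i) * mean_precision k $$ (j, i))"
      unfolding f_def using integrable_precision[OF k]
      by (subst integral_double_sum) (auto simp: mat_expectation_def)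
    also have "\<dots> = mat_trace (transpose_mat (S k) * mean_precision k)"
      using Sc[OF k] by (intro mat_trace_transpose_mult[symmetric]) (auto simp: mat_expectation_def)
    finally show ?thesis using St[OF k] by simp
  qed
  let ?g = "\<lambda>w. s\<^sup>2 * (\<Sum>k = 1..K. ?P / real (p k) * f k w) + 2 * real K * ?P * ln (sig w)
      - (real K * ?P * ln (s\<^sup>2) + real K * ?P)"
  have F: "integrable M (\<lambda>w. \<Sum>k = 1..K. ?P / real (p k) * f k w)"
    using f by (intro Bochner_Integration.integrable_sum integrable_mult_right) auto
  have g: "integrable M ?g"
    using F integrable_ln_sig by auto
  have "post_risk K p M s S = (\<integral>w. ?g w \<partial>M)"
    unfolding post_risk_def
  proof (rule integral_cong_AE)
    show "AE w in M. loss K p w s S = ?g w"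
      using AE_regular
    proof eventually_elim
      case (elim w)
      have tr: "(\<Sum>k = 1..K. ?P / real (p k) * f k w) = 1 / (sig w)\<^sup>2 *
         (\<Sum>k = 1..K. ?P / real (p k) * mat_trace (transpose_mat (S k) * mat_inv (Sig p w k)))"
        unfolding sum_distrib_left
        using elim by (intro sum.cong) (simp_all add: f_def scaled_trace_eq[OF Sc, symmetric])
      have ln: "ln (s\<^sup>2 / (sig w)\<^sup>2) = ln (s\<^sup>2) - 2 * ln (sig w)"
        using elim s by (simp add: ln_div ln_realpow)
      show ?case
        unfolding loss_def tr ln by (simp add: algebra_simps)
    qed
  qed (use g loss_measurable[OF Sc] in auto)
  also have "\<dots> = s\<^sup>2 * (\<Sum>k = 1..K. ?P / real (p k) * mat_trace (S k * mean_precision k))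
      + 2 * real K * ?P * (\<integral>w. ln (sig w) \<partial>M) - (real K * ?P * ln (s\<^sup>2) + real K * ?P)"
  proof -
    have "(\<integral>w. (\<Sum>k = 1..K. ?P / real (p k) * f k w) \<partial>M)
        = (\<Sum>k = 1..K. ?P / real (p k) * mat_trace (S k * mean_precision k))"
      using f by (simp add: If)
    then show ?thesis
      using F integrable_ln_sig by (simp add: prob_space)
  qed
  also have "(\<Sum>k = 1..K. ?P / real (p k) * mat_trace (S k * mean_precision k))
      = ?P * (\<Sum>k = 1..K. mat_trace (S k * mean_precision k) / real (p k))"
    by (simp add: sum_distrib_left)
  finally show ?thesis by (simp add: algebra_simps)
qed

section \<open>The minimiser\<close>

definition root_det :: "nat \<Rightarrow> real" where
  "root_det k = det (mean_precision k) powr (1 / real (p k))"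

lemma root_det_pos: "k \<in> {1..K} \<Longrightarrow> 0 < root_det k"
  using pos_def_mat_inverse(4)[OF mean_precision_pos_def, of k] by (simp add: root_det_def)

lemma sum_root_det_pos: "0 < (\<Sum>k = 1..K. root_det k)"
  using K by (intro sum_pos root_det_pos) auto

lemma det_E_mat: "k \<in> {1..K} \<Longrightarrow> det (E_mat p M k) = 1 / det (mean_precision k)"
  unfolding E_mat_def by (rule pos_def_mat_inverse(5)[OF mean_precision_pos_def])

text \<open>Inverting the mean precision inverts its determinant, so the normalising factor of
  \<open>E_mat\<close> is \<open>root_det k\<close>. This is the equality case of
  \<open>mat_trace_mult_ge\<close>.\<close>

lemma Sigma_hat_eq:
  assumes "k \<in> {1..K}"
  shows "Sigma_hat p M k = root_det k \<cdot>\<^sub>m mat_inv (mean_precision k)"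
proof -
  have "0 < det (mean_precision k)"
    by (rule pos_def_mat_inverse(4)[OF mean_precision_pos_def[OF assms]])
  then show ?thesis
    using det_E_mat[OF assms] by (simp add: Sigma_hat_def root_det_def powr_divide E_mat_def)
qed

lemma sigma2_hat_eq: "sigma2_hat K p M = real K / (\<Sum>k = 1..K. root_det k)"
proof -
  have "det (E_mat p M k) powr (- 1 / real (p k)) = root_det k" if "k \<in> {1..K}" for k
  proof -
    have "0 < det (mean_precision k)"
      by (rule pos_def_mat_inverse(4)[OF mean_precision_pos_def[OF that]])
    then show ?thesis
      using det_E_mat[OF that] by (simp add: root_det_def powr_divide powr_minus_divide)
  qed
  then have "(\<Sum>k = 1..K. 1 / real K * det (E_mat p M k) powr (- 1 / real (p k)))
      = (\<Sum>k = 1..K. root_det k) / real K"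
    by (simp add: sum_divide_distrib)
  then show ?thesis by (simp add: sigma2_hat_def)
qed

lemma sigma2_hat_pos: "0 < sigma2_hat K p M"
  using K sum_root_det_pos by (simp add: sigma2_hat_eq)

text \<open>\<open>S\<close> is a function on all naturals, but only its values on
  \<open>{1..K}\<close> matter; hence the formulation for every \<open>S\<close> agreeing with
  \<open>Sigma_hat\<close> there.\<close>

lemma admissible_hat:
  assumes "0 < s" "\<And>k. k \<in> {1..K} \<Longrightarrow> S k = Sigma_hat p M k"
  shows "admissible K p s S"
  unfolding admissible_def
proof (intro conjI ballI)
  fix k assume k: "k \<in> {1..K}"
  note pd = mean_precision_pos_def[OF k]
  have I: "pos_def_mat (p k) (mat_inv (mean_precision k))"
    by (rule pos_def_mat_inverse(1)[OF pd])
  show "pos_def_mat (p k) (S k)"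
    using assms(2)[OF k] Sigma_hat_eq[OF k] pos_def_mat_smult[OF I root_det_pos[OF k]] by simp
  have "dim_col (mat_inv (mean_precision k)) = p k"
    using I by (auto simp: pos_def_mat_def)
  then show "det (S k) = 1"
    using assms(2)[OF k] Sigma_hat_eq[OF k] pos_def_mat_inverse(4,5)[OF pd] p[OF k]
    by (simp add: root_det_def powr_power)
qed fact

text \<open>\<open>m\<close> is the risk formula with each normalised trace replaced by its least
  value \<open>root_det k\<close> and \<open>s\<^sup>2\<close> by \<open>sigma2_hat K p M\<close>,
  whose product with the sum of the \<open>root_det k\<close> is \<open>K\<close>. The excess over
  \<open>m\<close> is a positive multiple of \<open>s\<^sup>2\<close> times the trace gaps
  \<open>t k\<close> plus the gap \<open>r\<close> of the scalar problem, so it vanishes only if all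
  gaps do.\<close>

lemma post_risk_minimum:
  defines "m \<equiv> real (total_dim K p) * (real K - real K * ln (sigma2_hat K p M)
      + real K * (2 * (\<integral>w. ln (sig w) \<partial>M) - 1))"
  assumes S: "admissible K p s S"
  shows "m \<le> post_risk K p M s S"
    and "post_risk K p M s S = m \<longleftrightarrow>
      s\<^sup>2 = sigma2_hat K p M \<and> (\<forall>k\<in>{1..K}. S k = Sigma_hat p M k)"
proof -
  let ?P = "real (total_dim K p)" and ?D = "\<Sum>k = 1..K. root_det k"
  have P: "0 < ?P" using p by (force simp: total_dim_def intro!: prod_pos)
  have s: "0 < s" using S by (simp add: admissible_def)
  define t where "t k = mat_trace (S k * mean_precision k) / real (p k) - root_det k" for k
  have t: "0 \<le> t k" "t k = 0 \<longleftrightarrow> S k = Sigma_hat p M k" if k: "k \<in> {1..K}" for k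
  proof -
    have Sk: "pos_def_mat (p k) (S k)" "det (S k) = 1"
      using S k by (auto simp: admissible_def)
    have q: "0 < p k" using p[OF k] by simp
    note ge = mat_trace_mult_ge[OF Sk mean_precision_pos_def[OF k] q, folded root_det_def]
    show "0 \<le> t k" using ge(1) q by (simp add: t_def field_simps)
    have "t k = 0 \<longleftrightarrow> mat_trace (S k * mean_precision k) = real (p k) * root_det k"
      using q by (auto simp: t_def field_simps)
    then show "t k = 0 \<longleftrightarrow> S k = Sigma_hat p M k"
      using ge(2) Sigma_hat_eq[OF k] by simp
  qed
  define r where "r = s\<^sup>2 * ?D - real K * ln (s\<^sup>2) - (real K - real K * ln (real K / ?D))"
  have s2: "0 < s\<^sup>2" and K0: "0 < real K" using s K by auto
  have r: "0 \<le> r" "r = 0 \<longleftrightarrow> s\<^sup>2 = sigma2_hat K p M"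
    using linear_minus_ln_ge[OF s2 sum_root_det_pos K0] by (auto simp: r_def sigma2_hat_eq)
  have gap: "post_risk K p M s S - m = ?P * (s\<^sup>2 * (\<Sum>k = 1..K. t k) + r)"
    by (simp add: post_risk_eq[OF S] m_def r_def t_def sigma2_hat_eq sum_subtractf algebra_simps)
  have T: "0 \<le> (\<Sum>k = 1..K. t k)" using t(1) by (intro sum_nonneg) auto
  have "0 \<le> post_risk K p M s S - m"
    unfolding gap using P r(1) T by simp
  then show "m \<le> post_risk K p M s S" by simp
  have "post_risk K p M s S = m \<longleftrightarrow> ?P * (s\<^sup>2 * (\<Sum>k = 1..K. t k) + r) = 0"
    unfolding gap[symmetric] by simp
  also have "\<dots> \<longleftrightarrow> r = 0 \<and> (\<Sum>k = 1..K. t k) = 0"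
    using P s T r(1) by (auto simp: add_nonneg_eq_0_iff)
  also have "(\<Sum>k = 1..K. t k) = 0 \<longleftrightarrow> (\<forall>k\<in>{1..K}. t k = 0)"
    using t(1) by (intro sum_nonneg_eq_0_iff) auto
  finally show "post_risk K p M s S = m \<longleftrightarrow>
      s\<^sup>2 = sigma2_hat K p M \<and> (\<forall>k\<in>{1..K}. S k = Sigma_hat p M k)"
    using r(2) t(2) by auto
qed

lemma is_arg_min_post_risk:
  "is_arg_min (\<lambda>(s, S). post_risk K p M s S) (\<lambda>(s, S). admissible K p s S) (s, S) \<longleftrightarrow>
    0 < s \<and> s\<^sup>2 = sigma2_hat K p M \<and> (\<forall>k \<in> {1..K}. S k = Sigma_hat p M k)"
  (is "?min \<longleftrightarrow> ?hat s S")
proof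
  \<comment> \<open>This admissible pair attains the bound of \<open>post_risk_minimum\<close>. Any
    minimiser must therefore attain it too, and the equality case identifies it.\<close>
  let ?s = "sqrt (sigma2_hat K p M)" and ?S = "Sigma_hat p M"
  assume ?min
  then have adm: "admissible K p s S" and "\<not> post_risk K p M ?s ?S < post_risk K p M s S"
    using admissible_hat[of ?s ?S] sigma2_hat_pos by (auto simp: is_arg_min_def)
  moreover have "admissible K p ?s ?S"
    using admissible_hat sigma2_hat_pos by simp
  then have "post_risk K p M ?s ?S \<le> post_risk K p M s S"
    using post_risk_minimum[of ?s ?S] post_risk_minimum(1)[OF adm] sigma2_hat_pos by simp
  ultimately have "post_risk K p M s S = post_risk K p M ?s ?S" by simp
  then show "?hat s S"
    using post_risk_minimum(2)[OF \<open>admissible K p ?s ?S\<close>] post_risk_minimum(2)[OF adm]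
      sigma2_hat_pos adm by (simp add: admissible_def)
next
  assume hat: "?hat s S"
  then have adm: "admissible K p s S" by (intro admissible_hat) auto
  have "post_risk K p M s S \<le> post_risk K p M s' S'" if "admissible K p s' S'" for s' S'
    using post_risk_minimum(1)[OF that] post_risk_minimum(2)[OF adm] hat by simp
  with adm show ?min by (fastforce simp: is_arg_min_def)
qed

end

theorem proposition1:
  fixes K n :: nat and p :: "nat \<Rightarrow> nat" and X :: "nat list \<Rightarrow> real" and M :: "param measure"
  assumes "1 \<le> K" and "1 \<le> n" and "\<And>k. k \<in> {1..K} \<Longrightarrow> 1 \<le> p k"
    and "is_posterior K p n X M"
    and "\<And>k i j. k \<in> {1..K} \<Longrightarrow> i < p k \<Longrightarrow> j < p k \<Longrightarrow>
           integrable M (\<lambda>w. precision p w k $$ (i, j))"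
    and "integrable M (\<lambda>w. ln (sig w))"
  shows "0 < sigma2_hat K p M \<and>
    (\<forall>s S. is_arg_min (\<lambda>(s, S). post_risk K p M s S) (\<lambda>(s, S). admissible K p s S) (s, S) \<longleftrightarrow>
       0 < s \<and> s\<^sup>2 = sigma2_hat K p M \<and> (\<forall>k \<in> {1..K}. S k = Sigma_hat p M k))"
proof -
  interpret integrable_posterior K n p X M
    using assms by unfold_locales auto
  show ?thesis using sigma2_hat_pos is_arg_min_post_risk by blast
qed

end
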